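(* Let $p$ and $q$ be polynomials, with $p\not\equiv 0$ and $q$ non-constant, let $c\in\mathbb{C}$, and let $$f(z)=\int_0^z p(\zeta)e^{q(\zeta)}\,d\zeta+c .$$ Then there exist $t>0$ and $\beta>0$ such that $$\left|\frac{zf'(z)}{f(z)}\right|\geq\beta\,|\log f(z)|\quad\text{for all } z \text{ with } |f(z)|\geq e^t,$$ and hence the logarithmic transform $F$ of $f$ satisfies $$|F'(w)|\geq\beta\,|F(w)|\quad\text{for all } w \text{ in the domain of } F \text{ with } \operatorname{Re}F(w)\geq t.$$
   Context: $\operatorname{sing}(f^{-1})$ denotes the set of critical values and finite asymptotic values of $f$; for $f$ of the form $f(z)=\int_0^z p(\zeta)e^{q(\zeta)}\,d\zeta+c$, with polynomials $p\not\equiv 0$ and $q$ non-constant and $c\in\mathbb{C}$, it is finite. Choose $R>\max\{1,|f(0)|\}$ such that $\operatorname{sing}(f^{-1})\subset\{z\colon|z|<R\}$. Put $s:=\log R$, $\Delta:=\{z\in\mathbb{C}\colon |z|>R\}$ and $T:=\exp^{-1}(f^{-1}(\Delta))$. On $f^{-1}(\Delta)$ fix a holomorphic branch of $\log f$ (one branch on each component of $f^{-1}(\Delta)$). The logarithmic transform of $f$ is the $2\pi i$-periodic holomorphic map $F\colon T\to\{w\colon\operatorname{Re}w>s\}$, $F(w)=\log f(e^w)$, so that $f(e^w)=\exp F(w)$; it maps each component of $T$ biholomorphically onto $\{w\colon\operatorname{Re}w>s\}$. The expression $\log f(z)$ in the claim refers to this fixed branch (with $t$ large enough that $e^t>R$).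 *)

theory Defs
  imports "HOL-Complex_Analysis.Complex_Analysis" "HOL-Computational_Algebra.Polynomial"
begin

text \<open>The integral from 0 to z is taken along the straight segment; the integrand is entire,
  so the choice of path is immaterial.\<close>

definition poly_exp_integral ::
    "complex poly \<Rightarrow> complex poly \<Rightarrow> complex \<Rightarrow> complex \<Rightarrow> complex" where
  "poly_exp_integral p q c z =
     contour_integral (linepath 0 z) (\<lambda>\<zeta>. poly p \<zeta> * exp (poly q \<zeta>)) + c"

definition critical_values :: "(complex \<Rightarrow> complex) \<Rightarrow> complex set" where
  "critical_values f = {f z | z. deriv f z = 0}"

definition finite_asymptotic_values :: "(complex \<Rightarrow> complex) \<Rightarrow> complex set" where
  "finite_asymptotic_values f =
     {a. \<exists>\<gamma> :: real \<Rightarrow> complex. continuous_on {0..} \<gamma> \<and> filterlim \<gamma> at_infinity at_top \<and>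
           ((\<lambda>\<tau>. f (\<gamma> \<tau>)) \<longlongrightarrow> a) at_top}"

text \<open>The critical values and finite asymptotic values of an entire function; no closure is
  taken.\<close>

definition sing_inv :: "(complex \<Rightarrow> complex) \<Rightarrow> complex set" where
  "sing_inv f = critical_values f \<union> finite_asymptotic_values f"

definition tracts :: "(complex \<Rightarrow> complex) \<Rightarrow> real \<Rightarrow> complex set" where
  "tracts f R = f -` {z. cmod z > R}"

text \<open>Holomorphy on a possibly disconnected open set: the branch may be chosen independently on
  each component.\<close>

definition log_branch_on :: "complex set \<Rightarrow> (complex \<Rightarrow> complex) \<Rightarrow> (complex \<Rightarrow> complex) \<Rightarrow> bool" where
  "log_branch_on D f L \<longleftrightarrow> L holomorphic_on D \<and> (\<forall>z\<in>D. exp (L z) = f z)"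

definition log_transform_domain :: "(complex \<Rightarrow> complex) \<Rightarrow> real \<Rightarrow> complex set" where
  "log_transform_domain f R = exp -` tracts f R"

text \<open>L is the chosen branch of the logarithm of f; only the values on
  the domain above are meaningful.\<close>

definition log_transform :: "(complex \<Rightarrow> complex) \<Rightarrow> complex \<Rightarrow> complex" where
  "log_transform L w = L (exp w)"

end

theory Submission imports Defs "HOL-Real_Asymp.Real_Asymp"
begin

text \<open>
  Write \<open>d = deg q\<close>, \<open>m = deg p - d + 1\<close> and \<open>V(z) = |z|\<^sup>m |e\<^sup>q\<^sup>(\<^sup>z\<^sup>)|\<close>. Near infinity \<open>f\<close> differs from
  \<open>(p / q') e\<^sup>q\<close>, which has size \<open>V\<close>, by a bounded amount plus something of smaller order than \<open>V\<close>;
  this is \<open>exp_poly_primitive_size\<close>. Where \<open>|f|\<close> is large, \<open>|f|\<close> is therefore comparable to \<open>V\<close>. As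
  \<open>|z f'(z)| = |z p(z) e\<^sup>q\<^sup>(\<^sup>z\<^sup>)|\<close> is comparable to \<open>|z|\<^sup>d V(z)\<close>, the quotient \<open>|z f'(z) / f(z)|\<close> is comparable
  to \<open>|z|\<^sup>d\<close>. What remains is \<open>L(z) = O(|z|\<^sup>d)\<close> for the given branch \<open>L\<close> of \<open>log f\<close>, which is
  \<open>log_branch_growth\<close>: it follows by integrating \<open>L' = f' / f\<close> along an arc and a ray that stay where \<open>|f|\<close> is
  large and end in a compact set independent of \<open>z\<close>. The statement on \<open>F\<close> is the same
  inequality at \<open>z = e\<^sup>w\<close>, because \<open>F'(w) = z f'(z) / f(z)\<close> and \<open>Re F(w) = log |f(z)|\<close>.

  Both estimates integrate along rays and circular arcs on which \<open>Re q\<close> increases at a rate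
  proportional to the largest possible one. On such a path \<open>|e\<^sup>q|\<close> dominates its own integral, with a
  gain of \<open>|z|\<^sup>-\<^sup>d\<close> (\<open>exp_growth_controls_ascent\<close>). Three kinds of paths suffice. If \<open>a z\<^sup>d\<close> is the leading
  term of \<open>q\<close>, then rays lead outwards from a fixed circle over the sectors around \<open>a z\<^sup>d > 0\<close>, rays
  lead inwards to a fixed circle over the sectors around \<open>a z\<^sup>d < 0\<close>, and arcs lead from the latter
  sectors to the former.
\<close>

section \<open>Polynomials near infinity\<close>

definition lead_term :: "complex poly \<Rightarrow> complex \<Rightarrow> complex" where
  "lead_term q z = lead_coeff q * z ^ degree q"

lemma poly_lead_term_close:
  fixes q :: "complex poly"
  assumes "e > 0"
  shows "\<forall>\<^sub>F z in at_infinity. norm (poly q z - lead_term q z) \<le> e * norm z ^ degree q"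
proof -
  have "\<forall>\<^sub>F z in at_infinity. dist (poly q z / z ^ degree q) (lead_coeff q) < e"
    using poly_divide_tendsto_aux[of q] assms by (simp add: tendsto_iff)
  moreover have "\<forall>\<^sub>F z::complex in at_infinity. norm z \<ge> 1"
    by (auto simp: eventually_at_infinity)
  ultimately show ?thesis
  proof eventually_elim
    case (elim z)
    then have z: "z \<noteq> 0" by auto
    have "poly q z - lead_term q z = (poly q z / z ^ degree q - lead_coeff q) * z ^ degree q"
      using z by (simp add: lead_term_def left_diff_distrib)
    with elim show ?case
      by (simp add: dist_norm norm_mult norm_power mult_right_mono)
  qed
qed

lemma poly_lower_bound:
  fixes p :: "complex poly"
  assumes "p \<noteq> 0"
  shows "\<forall>\<^sub>F z in at_infinity. norm (lead_coeff p) / 2 * norm z ^ degree p \<le> norm (poly p z)"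
proof -
  have "norm (lead_coeff p) / 2 > 0" using assms by simp
  from poly_lead_term_close[OF this, of p] show ?thesis
  proof eventually_elim
    case (elim z)
    have "norm (lead_term p z) - norm (poly p z) \<le> norm (poly p z - lead_term p z)"
      by (metis norm_minus_commute norm_triangle_ineq2)
    with elim show ?case by (simp add: lead_term_def norm_mult norm_power)
  qed
qed

lemma poly_upper_bound:
  fixes p :: "complex poly"
  assumes "degree p \<le> N"
  obtains C where "C > 0" "\<And>z. norm z \<ge> 1 \<Longrightarrow> norm (poly p z) \<le> C * norm z ^ N"
proof
  define C where "C = (\<Sum>i\<le>degree p. norm (coeff p i)) + 1"
  show "C > 0" unfolding C_def by (simp add: add_nonneg_pos sum_nonneg)
  fix z :: complex assume z: "norm z \<ge> 1"
  have "norm (poly p z) \<le> (\<Sum>i\<le>degree p. norm (coeff p i) * norm z ^ i)"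
    unfolding poly_altdef by (intro order.trans[OF norm_sum]) (simp add: norm_mult norm_power)
  also have "\<dots> \<le> (\<Sum>i\<le>degree p. norm (coeff p i) * norm z ^ N)"
    using z assms by (intro sum_mono mult_left_mono power_increasing) auto
  also have "\<dots> \<le> C * norm z ^ N"
    unfolding C_def by (simp add: distrib_right flip: sum_distrib_right)
  finally show "norm (poly p z) \<le> C * norm z ^ N" .
qed

section \<open>Growth of the comparison function along logarithmic spirals\<close>

text \<open>The exponent \<open>k\<close> is real because the weight
  that belongs to \<open>f\<close>, namely \<open>deg p - deg q + 1\<close>, may be negative.\<close>

definition exp_growth :: "complex poly \<Rightarrow> real \<Rightarrow> complex \<Rightarrow> real" where
  "exp_growth q k z = norm z powr k * exp (Re (poly q z))"

text \<open>For \<open>|v| = 1\<close> this is a straight line with unit speed in the coordinate \<open>log z\<close>. Only two kinds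
  are travelled later: rays (\<open>v = \<plusminus>1\<close>) and circles around the origin (\<open>v = \<plusminus>\<i>\<close>); the common
  parametrisation lets one growth estimate serve both.\<close>

definition spiral :: "complex \<Rightarrow> complex \<Rightarrow> real \<Rightarrow> complex" where
  "spiral z v \<tau> = z * exp (v * of_real \<tau>)"

text \<open>Since \<open>z q'(z)\<close> is close to \<open>d a z\<^sup>d\<close>, where \<open>a z\<^sup>d\<close> is the leading term of \<open>q\<close>, the derivative of
  \<open>Re q\<close> along a spiral is about \<open>d Re (v a z\<^sup>d)\<close>. The condition below says that a fixed fraction of the
  largest possible growth is attained. The fraction one half is what the sectors of opening angle
  \<open>2\<pi>/3\<close> in the plane of \<open>a z\<^sup>d\<close> used further down permit.\<close>

definition ascends :: "complex poly \<Rightarrow> real \<Rightarrow> complex \<Rightarrow> complex \<Rightarrow> real \<Rightarrow> real \<Rightarrow> bool" where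
  "ascends q r v z a b \<longleftrightarrow> norm v = 1 \<and> a \<le> b \<and>
     (\<forall>\<tau>\<in>{a..b}. r \<le> norm (spiral z v \<tau>) \<and>
        norm (lead_term q (spiral z v \<tau>)) / 2 \<le> Re (v * lead_term q (spiral z v \<tau>)))"

lemma exp_growth_pos: "z \<noteq> 0 \<Longrightarrow> exp_growth q k z > 0"
  by (simp add: exp_growth_def)

lemma exp_growth_nonneg: "exp_growth q k z \<ge> 0"
  by (simp add: exp_growth_def)

lemma exp_growth_add:
  "z \<noteq> 0 \<Longrightarrow> exp_growth q (k + real j) z = norm z ^ j * exp_growth q k z"
  by (simp add: exp_growth_def powr_add powr_realpow)

lemma norm_spiral: "norm (spiral z v \<tau>) = norm z * exp (Re v * \<tau>)"
  by (simp add: spiral_def norm_mult)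

lemma lead_term_spiral:
  "lead_term q (spiral z v \<tau>) = lead_term q z * exp (v * of_real (real (degree q) * \<tau>))"
  by (simp add: lead_term_def spiral_def power_mult_distrib mult_ac flip: exp_of_nat_mult)

lemma spiral_0 [simp]: "spiral z v 0 = z"
  by (simp add: spiral_def)

lemma spiral_has_vector_derivative:
  "(spiral z v has_vector_derivative v * spiral z v \<tau>) (at \<tau>)"
proof -
  have "((\<lambda>w. z * exp (v * w)) has_field_derivative v * spiral z v \<tau>) (at (of_real \<tau>))"
    by (auto intro!: derivative_eq_intros simp: spiral_def)
  from has_vector_derivative_real_field[OF this] show ?thesis
    by (simp add: spiral_def[abs_def])
qed

lemma exp_growth_spiral_derivative:
  assumes "z \<noteq> 0"
  shows "((\<lambda>\<tau>. exp_growth q k (spiral z v \<tau>)) has_vector_derivative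
     (k * Re v + Re (v * (spiral z v \<tau> * poly (pderiv q) (spiral z v \<tau>))))
       * exp_growth q k (spiral z v \<tau>)) (at \<tau>)"
proof -
  have eq: "exp_growth q k (spiral z v \<tau>)
      = norm z powr k * exp (k * (Re v * \<tau>) + Re (poly q (spiral z v \<tau>)))" for \<tau>
    by (simp add: exp_growth_def norm_spiral powr_mult exp_add powr_def[of "exp _"])
  have "((\<lambda>\<tau>. poly q (spiral z v \<tau>)) has_vector_derivative
      (v * spiral z v \<tau>) * poly (pderiv q) (spiral z v \<tau>)) (at \<tau>)"
    using field_vector_diff_chain_at[OF spiral_has_vector_derivative poly_DERIV]
    by (simp add: o_def)
  then have "((\<lambda>\<tau>. Re (poly q (spiral z v \<tau>))) has_vector_derivative
      Re ((v * spiral z v \<tau>) * poly (pderiv q) (spiral z v \<tau>))) (at \<tau>)"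
    by (rule bounded_linear.has_vector_derivative[OF bounded_linear_Re])
  then have *: "((\<lambda>\<tau>. Re (poly q (spiral z v \<tau>))) has_real_derivative
      Re (v * (spiral z v \<tau> * poly (pderiv q) (spiral z v \<tau>)))) (at \<tau>)"
    by (simp add: has_real_derivative_iff_has_vector_derivative mult.assoc)
  show ?thesis
    unfolding eq has_real_derivative_iff_has_vector_derivative[symmetric]
    by (rule derivative_eq_intros DERIV_cmult DERIV_fun_exp * refl)+ (simp add: algebra_simps)
qed

text \<open>The leading term of \<open>z q'(z)\<close> contributes at least \<open>d |a| |z|\<^sup>d / 2\<close> to the logarithmic derivative of the
  growth function. For large \<open>z\<close> half of this pays for the lower order terms of \<open>z q'(z)\<close> and a quarter
  for the weight \<open>|z|\<^sup>k\<close>, whose logarithmic derivative is bounded by \<open>|k|\<close>.\<close>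

lemma exp_growth_rate:
  fixes q :: "complex poly"
  assumes q: "degree q > 0"
  obtains \<delta> r where "\<delta> > 0" "r \<ge> 1"
    "\<And>v z. norm v = 1 \<Longrightarrow> r \<le> norm z \<Longrightarrow> norm (lead_term q z) / 2 \<le> Re (v * lead_term q z)
       \<Longrightarrow> \<delta> * norm z ^ degree q \<le> k * Re v + Re (v * (z * poly (pderiv q) z))"
proof -
  define d where "d = degree q"
  define c where "c = real d * norm (lead_coeff q)"
  have "q \<noteq> 0" using q by auto
  then have c: "c > 0" using q by (simp add: c_def d_def)
  define Q where "Q = pCons 0 (pderiv q)"
  have pd: "pderiv q \<noteq> 0" using q by (simp add: pderiv_eq_0_iff)
  have dQ: "degree Q = d" using q pd by (simp add: Q_def degree_pderiv d_def)
  have lQ: "lead_coeff Q = of_nat d * lead_coeff q"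
    unfolding dQ using q by (cases d) (auto simp: Q_def coeff_pderiv d_def)
  have ltQ: "lead_term Q z = of_nat d * lead_term q z" for z
    unfolding lead_term_def lQ by (simp add: dQ d_def)
  have "\<forall>\<^sub>F z in at_infinity. norm (poly Q z - lead_term Q z) \<le> c / 4 * norm z ^ degree Q"
    using c by (intro poly_lead_term_close) auto
  moreover have "\<forall>\<^sub>F z::complex in at_infinity. norm z \<ge> max 1 (8 * \<bar>k\<bar> / c)"
    unfolding eventually_at_infinity by (rule exI[of _ "max 1 (8 * \<bar>k\<bar> / c)"]) blast
  ultimately have "\<forall>\<^sub>F z in at_infinity. norm (poly Q z - lead_term Q z) \<le> c / 4 * norm z ^ d
      \<and> norm z \<ge> max 1 (8 * \<bar>k\<bar> / c)"
    unfolding dQ by (rule eventually_conj)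
  then obtain r where r: "\<And>z. r \<le> norm z \<Longrightarrow> norm (poly Q z - lead_term Q z) \<le> c / 4 * norm z ^ d
      \<and> norm z \<ge> max 1 (8 * \<bar>k\<bar> / c)"
    unfolding eventually_at_infinity by auto
  show ?thesis
  proof (rule that[of "c / 8" "max 1 r"])
    fix v z :: complex
    assume v: "norm v = 1" and z: "max 1 r \<le> norm z"
      and up: "norm (lead_term q z) / 2 \<le> Re (v * lead_term q z)"
    note rz = r[of z]
    have "8 * \<bar>k\<bar> / c \<le> norm z ^ 1" using rz z by simp
    also have "\<dots> \<le> norm z ^ d" using z q by (intro power_increasing) (auto simp: d_def)
    finally have k: "\<bar>k\<bar> \<le> c / 8 * norm z ^ d" using c by (simp add: field_simps)
    have "\<bar>k * Re v\<bar> \<le> \<bar>k\<bar> * 1"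
      unfolding abs_mult using abs_Re_le_cmod[of v] v by (intro mult_left_mono) auto
    then have kv: "k * Re v \<ge> - (c / 8 * norm z ^ d)" using k by linarith
    have "c / 2 * norm z ^ d \<le> Re (v * lead_term Q z)"
    proof -
      have "d * (norm (lead_term q z) / 2) \<le> d * Re (v * lead_term q z)"
        using up by (intro mult_left_mono) auto
      also have "\<dots> = Re (v * lead_term Q z)" by (simp add: ltQ algebra_simps)
      finally show ?thesis by (simp add: lead_term_def c_def norm_mult norm_power d_def mult_ac)
    qed
    moreover have "\<bar>Re (v * (poly Q z - lead_term Q z))\<bar> \<le> c / 4 * norm z ^ d"
      using abs_Re_le_cmod[of "v * (poly Q z - lead_term Q z)"] rz z v by (simp add: norm_mult)
    moreover have "Re (v * (poly Q z - lead_term Q z)) = Re (v * poly Q z) - Re (v * lead_term Q z)"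
      by (simp only: right_diff_distrib minus_complex.sel)
    ultimately have "Re (v * poly Q z) \<ge> c / 4 * norm z ^ d"
      by linarith
    then show "c / 8 * norm z ^ degree q \<le> k * Re v + Re (v * (z * poly (pderiv q) z))"
      using kv by (simp add: Q_def d_def)
  qed (use c in auto)
qed

lemma differentiable_bound_along:
  fixes g :: "real \<Rightarrow> 'a::real_normed_vector"
  assumes "a \<le> b"
    and "\<And>\<tau>. \<tau> \<in> {a..b} \<Longrightarrow> (g has_vector_derivative g' \<tau>) (at \<tau>)"
    and "\<And>\<tau>. \<tau> \<in> {a..b} \<Longrightarrow> (\<phi> has_vector_derivative \<phi>' \<tau>) (at \<tau>)"
    and "\<And>\<tau>. \<tau> \<in> {a..b} \<Longrightarrow> norm (g' \<tau>) \<le> \<phi>' \<tau>"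
  shows "norm (g b - g a) \<le> \<phi> b - \<phi> a"
proof (cases "a = b")
  case False
  then have "a < b" using assms(1) by simp
  show ?thesis
  proof (rule differentiable_bound_general[OF \<open>a < b\<close>])
    show "continuous_on {a..b} g" "continuous_on {a..b} \<phi>"
      by (meson assms continuous_at_imp_continuous_on has_vector_derivative_continuous)+
    fix x assume "a < x" "x < b"
    then have "x \<in> {a..b}" by simp
    then show "(g has_vector_derivative g' x) (at x)"
      "(\<phi> has_vector_derivative \<phi>' x) (at x)" "norm (g' x) \<le> \<phi>' x"
      using assms by blast+
  qed
qed simp

text \<open>On an ascending spiral the growth function increases so fast that \<open>C / \<delta>\<close> times it majorises every
  \<open>h\<close> with \<open>|z h'(z)| \<le> C |z|\<^sup>d |z|\<^sup>k |e\<^sup>q|\<close>: integrating gains the factor \<open>|z|\<^sup>-\<^sup>d\<close>. The bound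
  involves the upper end of the spiral only, so the spiral may start anywhere. The radius \<open>r'\<close>
  allows \<open>h\<close> to be defined or controlled only farther out.\<close>

lemma exp_growth_controls_ascent:
  fixes q :: "complex poly"
  assumes q: "degree q > 0"
  obtains \<delta> r where "\<delta> > 0" "r \<ge> 1"
    "\<And>v z a b. ascends q r v z a b
       \<Longrightarrow> exp_growth q k (spiral z v a) \<le> exp_growth q k (spiral z v b)"
    "\<And>h h' v z a b C r'. r \<le> r' \<Longrightarrow> ascends q r' v z a b \<Longrightarrow> C \<ge> 0 \<Longrightarrow>
       (\<And>z. r' \<le> norm z \<Longrightarrow> (h has_field_derivative h' z) (at z)
           \<and> norm (z * h' z) \<le> C * (norm z ^ degree q * exp_growth q k z)) \<Longrightarrow>
       norm (h (spiral z v b) - h (spiral z v a)) \<le> C / \<delta> * exp_growth q k (spiral z v b)"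
proof -
  obtain \<delta> r where \<delta>: "\<delta> > 0" and r: "r \<ge> 1" and rate:
    "\<And>v z. norm v = 1 \<Longrightarrow> r \<le> norm z \<Longrightarrow> norm (lead_term q z) / 2 \<le> Re (v * lead_term q z)
       \<Longrightarrow> \<delta> * norm z ^ degree q \<le> k * Re v + Re (v * (z * poly (pderiv q) z))"
    using exp_growth_rate[OF q] by metis
  have main: "norm (h (spiral z v b) - h (spiral z v a))
      \<le> C / \<delta> * exp_growth q k (spiral z v b) - C / \<delta> * exp_growth q k (spiral z v a)"
    if r': "r \<le> r'" and asc: "ascends q r' v z a b" and C: "C \<ge> 0" and h: "\<And>z. r' \<le> norm z \<Longrightarrow>
       (h has_field_derivative h' z) (at z)
           \<and> norm (z * h' z) \<le> C * (norm z ^ degree q * exp_growth q k z)"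
    for h h' :: "complex \<Rightarrow> complex" and v z a b C r'
  proof (rule differentiable_bound_along)
    let ?\<gamma> = "spiral z v"
    show "a \<le> b" using asc by (simp add: ascends_def)
    fix \<tau> assume \<tau>: "\<tau> \<in> {a..b}"
    have large: "r' \<le> norm (?\<gamma> \<tau>)" using asc \<tau> by (auto simp: ascends_def)
    then have z: "z \<noteq> 0" using r r' by (auto simp: spiral_def)
    show "((\<lambda>\<tau>. h (?\<gamma> \<tau>)) has_vector_derivative (v * ?\<gamma> \<tau>) * h' (?\<gamma> \<tau>)) (at \<tau>)"
      using field_vector_diff_chain_at[OF spiral_has_vector_derivative, of h] h[OF large]
      by (simp add: o_def)
    show "((\<lambda>\<tau>. C / \<delta> * exp_growth q k (?\<gamma> \<tau>)) has_vector_derivative C / \<delta> *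
       ((k * Re v + Re (v * (?\<gamma> \<tau> * poly (pderiv q) (?\<gamma> \<tau>)))) * exp_growth q k (?\<gamma> \<tau>))) (at \<tau>)"
      by (intro has_vector_derivative_mult_right exp_growth_spiral_derivative z)
    have v: "norm v = 1" using asc by (simp add: ascends_def)
    then have "norm ((v * ?\<gamma> \<tau>) * h' (?\<gamma> \<tau>)) = norm (?\<gamma> \<tau> * h' (?\<gamma> \<tau>))"
      by (simp add: norm_mult)
    also have "\<dots> \<le> C * (norm (?\<gamma> \<tau>) ^ degree q * exp_growth q k (?\<gamma> \<tau>))"
      using h[OF large] by blast
    also have "\<dots> = C / \<delta> * ((\<delta> * norm (?\<gamma> \<tau>) ^ degree q) * exp_growth q k (?\<gamma> \<tau>))"
      using \<delta> by simp
    also have "\<dots> \<le> C / \<delta> *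
       ((k * Re v + Re (v * (?\<gamma> \<tau> * poly (pderiv q) (?\<gamma> \<tau>)))) * exp_growth q k (?\<gamma> \<tau>))"
      using asc \<tau> v C \<delta> order.trans[OF r' large]
      by (intro mult_left_mono mult_right_mono rate exp_growth_nonneg)
         (auto simp: ascends_def simp del: times_complex.sel)
    finally show "norm ((v * ?\<gamma> \<tau>) * h' (?\<gamma> \<tau>)) \<le> \<dots>" .
  qed
  show ?thesis
  proof (rule that[OF \<delta> r])
    fix v z :: complex and a b :: real assume asc: "ascends q r v z a b"
    show "exp_growth q k (spiral z v a) \<le> exp_growth q k (spiral z v b)"
      using main[OF order.refl asc, of \<delta> "\<lambda>_. 0" "\<lambda>_. 0"] \<delta> by (simp add: exp_growth_nonneg)
  next
    fix h h' :: "complex \<Rightarrow> complex" and v z :: complex and a b C r' :: real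
    assume "r \<le> r'" "ascends q r' v z a b" and "C \<ge> 0" and "\<And>z. r' \<le> norm z \<Longrightarrow>
       (h has_field_derivative h' z) (at z)
           \<and> norm (z * h' z) \<le> C * (norm z ^ degree q * exp_growth q k z)"
    moreover have "0 \<le> C / \<delta> * exp_growth q k (spiral z v a)"
      using \<delta> \<open>C \<ge> 0\<close> by (simp add: exp_growth_nonneg)
    ultimately show "norm (h (spiral z v b) - h (spiral z v a)) \<le> C / \<delta> * exp_growth q k (spiral z v b)"
      using main by fastforce
  qed
qed


section \<open>Hills, valleys and the arcs between them\<close>

text \<open>In the plane of \<open>w = a z\<^sup>d\<close>, the leading term, these are the two sectors of points at angle at most
  \<open>\<pi>/3\<close> from the positive and from the negative real axis. Moving outwards ascends on a hill and moving
  inwards ascends in a valley. On the remaining two sectors, around the imaginary axis, \<open>|Im w|\<close> exceeds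
  \<open>|w| / 2\<close>, and turning towards the hill ascends.\<close>

definition hill :: "complex poly \<Rightarrow> complex set" where
  "hill q = {z. norm (lead_term q z) / 2 \<le> Re (lead_term q z)}"

definition valley :: "complex poly \<Rightarrow> complex set" where
  "valley q = {z. norm (lead_term q z) / 2 \<le> - Re (lead_term q z)}"

text \<open>Multiplication by \<open>e\<^sup>\<tau>\<close> does not change the argument of the leading term, so the ascent condition
  holds on a whole ray once it holds at one of its points. The hypothesis on \<open>\<tau>\<close> keeps the ray outside
  the disc of radius \<open>r\<close>.\<close>

lemma ascends_radial:
  fixes q :: "complex poly" and z v :: complex
  assumes r: "0 < r" "r \<le> norm z"
    and v: "v = 1 \<and> z \<in> hill q \<or> v = - 1 \<and> z \<in> valley q"
    and ab: "a \<le> b" "\<And>\<tau>. \<tau> \<in> {a..b} \<Longrightarrow> ln (r / norm z) \<le> Re v * \<tau>"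
  shows "ascends q r v z a b"
  unfolding ascends_def
proof (intro conjI ballI)
  show "norm v = 1" "a \<le> b" using v ab by auto
  fix \<tau> assume \<tau>: "\<tau> \<in> {a..b}"
  have "0 < norm z" using r by linarith
  then have "r / norm z = exp (ln (r / norm z))" using r by simp
  also have "\<dots> \<le> exp (Re v * \<tau>)" using ab(2)[OF \<tau>] by simp
  finally show "r \<le> norm (spiral z v \<tau>)"
    using \<open>0 < norm z\<close> by (simp add: norm_spiral pos_divide_le_eq mult.commute)
  define x where "x = exp (Re v * (real (degree q) * \<tau>))"
  have "exp (v * of_real (real (degree q) * \<tau>)) = of_real x"
    using v by (auto simp: x_def simp flip: exp_of_real)
  then have eq: "lead_term q (spiral z v \<tau>) = of_real x * lead_term q z"
    by (simp only: lead_term_spiral mult.commute)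
  have x: "x > 0" by (simp add: x_def)
  have "norm (lead_term q z) / 2 \<le> Re (v * lead_term q z)"
    using v by (auto simp: hill_def valley_def)
  from mult_left_mono[OF this, of x] x
  show "norm (lead_term q (spiral z v \<tau>)) / 2 \<le> Re (v * lead_term q (spiral z v \<tau>))"
    unfolding eq by (simp add: norm_mult algebra_simps)
qed

lemma hill_scale:
  assumes "x > 0" "z \<in> hill q"
  shows "of_real x * z \<in> hill q"
proof -
  have eq: "lead_term q (of_real x * z) = of_real (x ^ degree q) * lead_term q z"
    by (simp add: lead_term_def power_mult_distrib)
  have "x ^ degree q * (norm (lead_term q z) / 2) \<le> x ^ degree q * Re (lead_term q z)"
    using assms by (intro mult_left_mono) (auto simp: hill_def)
  then show ?thesis
    using assms(1) unfolding hill_def eq mem_Collect_eq by (simp add: norm_mult norm_power)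
qed

lemma ascends_radial_hill:
  assumes r: "0 < r" "r \<le> norm z" and z: "z \<in> hill q"
  obtains a where "a \<le> 0" "norm (spiral z 1 a) = r" "ascends q r 1 z a 0"
     "\<And>\<tau>. spiral z 1 \<tau> \<in> hill q"
proof (rule that[of "ln (r / norm z)"])
  have "0 < norm z" using r by linarith
  then show "ln (r / norm z) \<le> 0" "norm (spiral z 1 (ln (r / norm z))) = r"
    using r by (auto simp: norm_spiral field_simps)
  then show "ascends q r 1 z (ln (r / norm z)) 0"
    using r z by (intro ascends_radial) auto
  fix \<tau>
  have "spiral z 1 \<tau> = of_real (exp \<tau>) * z" by (simp add: spiral_def exp_of_real)
  then show "spiral z 1 \<tau> \<in> hill q" using z hill_scale[of "exp \<tau>"] by simp
qed

lemma ascends_radial_valley: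
  assumes r: "0 < r" "r \<le> norm z" and z: "z \<in> valley q"
  obtains b where "b \<ge> 0" "norm (spiral z (- 1) b) = r" "ascends q r (- 1) z 0 b"
proof (rule that[of "- ln (r / norm z)"])
  have "0 < norm z" using r by linarith
  then show "- ln (r / norm z) \<ge> 0" "norm (spiral z (- 1) (- ln (r / norm z))) = r"
    using r by (auto simp: norm_spiral field_simps)
  then show "ascends q r (- 1) z 0 (- ln (r / norm z))"
    using r z by (intro ascends_radial) auto
qed

lemma sin_ge_half:
  assumes "pi / 3 \<le> \<theta>" "\<theta> \<le> 2 * pi / 3"
  shows "1 / 2 \<le> sin \<theta>"
proof -
  have "cos (pi / 3) \<le> cos \<bar>pi / 2 - \<theta>\<bar>"
    using assms pi_gt_zero by (intro cos_monotone_0_pi_le) (auto simp: abs_if)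
  also have "cos \<bar>pi / 2 - \<theta>\<bar> = sin \<theta>" by (simp add: cos_diff)
  finally show ?thesis by (simp add: cos_60)
qed

lemma cos_ge_half:
  assumes "0 \<le> \<theta>" "\<theta> \<le> pi / 3"
  shows "1 / 2 \<le> cos \<theta>"
  using cos_monotone_0_pi_le[of \<theta> "pi / 3"] assms by (simp add: cos_60)

lemma cos_le_minus_half:
  assumes "2 * pi / 3 \<le> \<theta>" "\<theta> \<le> pi"
  shows "cos \<theta> \<le> - 1 / 2"
  using cos_monotone_0_pi_le[of "2 * pi / 3" \<theta>] assms by (simp add: cos_120)

lemma polar_sign:
  obtains s \<psi> where "s = 1 \<or> s = -1" "0 \<le> \<psi>" "\<psi> \<le> pi"
    "w = of_real (norm w) * cis (s * \<psi>)"
proof (cases "Arg w \<ge> 0")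
  case True
  then show ?thesis
    using that[of 1 "Arg w"] Arg_bounded[of w] rcis_cmod_Arg[of w] by (simp add: rcis_def)
next
  case False
  then show ?thesis
    using that[of "-1" "- Arg w"] Arg_bounded[of w] rcis_cmod_Arg[of w] by (simp add: rcis_def)
qed

text \<open>Turning \<open>z\<close> by \<open>-s \<tau>\<close> turns the leading term by \<open>-s d \<tau>\<close>, where \<open>s\<close> is the sign of its argument
  \<open>s \<psi>\<close>. Hence \<open>\<psi>\<close> runs through the interval from \<open>2\<pi>/3\<close> (edge of a valley) to \<open>\<pi>/3\<close> (edge of a
  hill), and \<open>Re (v w) = |w| sin \<psi>\<close>, for \<open>w\<close> the leading term, is at least \<open>|w| / 2\<close> on the way. The parameter \<open>0\<close> corresponds to
  \<open>z\<close> itself.\<close>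

lemma arc_valley_to_hill:
  fixes q :: "complex poly"
  assumes q: "degree q > 0" and z: "z \<notin> hill q" "z \<notin> valley q"
  obtains v a b where "a \<le> 0" "0 \<le> b" "b \<le> pi" "norm v = 1"
    "\<And>\<tau>. norm (spiral z v \<tau>) = norm z"
    "\<And>r. r \<le> norm z \<Longrightarrow> ascends q r v z a b"
    "spiral z v a \<in> valley q" "spiral z v b \<in> hill q"
proof -
  define d where "d = real (degree q)"
  have d: "d \<ge> 1" using q by (simp add: d_def)
  define M where "M = norm (lead_term q z)"
  obtain s \<psi> where s: "s = 1 \<or> s = -1" and \<psi>: "0 \<le> \<psi>" "\<psi> \<le> pi"
    and w: "lead_term q z = of_real M * cis (s * \<psi>)"
    unfolding M_def by (rule polar_sign)
  define v :: complex where "v = - \<i> * of_real s"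
  have re: "Re (lead_term q (spiral z v \<tau>)) = M * cos (\<psi> - d * \<tau>)"
    and rev: "Re (v * lead_term q (spiral z v \<tau>)) = M * sin (\<psi> - d * \<tau>)"
    and nm: "norm (lead_term q (spiral z v \<tau>)) = M" for \<tau>
  proof -
    have "exp (v * of_real (d * \<tau>)) = cis (- (s * (d * \<tau>)))"
      by (simp add: v_def cis_conv_exp mult_ac)
    then have eq: "lead_term q (spiral z v \<tau>) = of_real M * cis (s * (\<psi> - d * \<tau>))"
      unfolding lead_term_spiral w d_def[symmetric]
      by (simp add: cis_mult algebra_simps)
    have "d * \<tau> - \<psi> = - (\<psi> - d * \<tau>)" by simp
    then have "cos (d * \<tau> - \<psi>) = cos (\<psi> - d * \<tau>)" "- sin (d * \<tau> - \<psi>) = sin (\<psi> - d * \<tau>)"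
      by (metis cos_minus, metis sin_minus minus_minus)
    then show "Re (lead_term q (spiral z v \<tau>)) = M * cos (\<psi> - d * \<tau>)"
      "Re (v * lead_term q (spiral z v \<tau>)) = M * sin (\<psi> - d * \<tau>)"
      "norm (lead_term q (spiral z v \<tau>)) = M"
      unfolding eq using s by (auto simp: v_def norm_mult M_def)
  qed
  have M: "M \<ge> 0" by (simp add: M_def)
  have range: "pi / 3 < \<psi>" "\<psi> < 2 * pi / 3"
  proof -
    have "\<not> M / 2 \<le> M * cos \<psi>" "\<not> M / 2 \<le> - (M * cos \<psi>)"
      using z re[of 0] nm[of 0] by (simp_all add: hill_def valley_def)
    moreover have "M / 2 \<le> M * x" if "1 / 2 \<le> x" for x
      using mult_left_mono[OF that M] by simp
    ultimately have "\<not> 1 / 2 \<le> cos \<psi>" "\<not> 1 / 2 \<le> - cos \<psi>"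
      by (metis, metis mult_minus_right)
    then show "pi / 3 < \<psi>" "\<psi> < 2 * pi / 3"
      using cos_ge_half[of \<psi>] cos_le_minus_half[of \<psi>] \<psi> by (force, force)
  qed
  define a where "a = (\<psi> - 2 * pi / 3) / d"
  define b where "b = (\<psi> - pi / 3) / d"
  have ends: "\<psi> - d * a = 2 * pi / 3" "\<psi> - d * b = pi / 3"
    using d by (simp_all add: a_def b_def)
  show ?thesis
  proof (rule that)
    show ab: "a \<le> 0" "0 \<le> b" using range d by (auto simp: a_def b_def field_simps)
    have "b \<le> d * b" using d ab by (simp add: mult_le_cancel_right1)
    also have "\<dots> \<le> pi" using ends range pi_gt_zero by linarith
    finally show "b \<le> pi" .
    show v: "norm v = 1" using s by (auto simp: v_def)
    show const: "norm (spiral z v \<tau>) = norm z" for \<tau> by (simp add: norm_spiral v_def)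
    show "spiral z v a \<in> valley q" "spiral z v b \<in> hill q"
      unfolding hill_def valley_def mem_Collect_eq re nm ends by (simp_all add: cos_60 cos_120)
    fix r assume r: "r \<le> norm z"
    show "ascends q r v z a b"
      unfolding ascends_def
    proof (intro conjI ballI)
      fix \<tau> assume \<tau>: "\<tau> \<in> {a..b}"
      have "d * a \<le> d * \<tau>" "d * \<tau> \<le> d * b" using \<tau> d by (auto intro!: mult_left_mono)
      then have "1 / 2 \<le> sin (\<psi> - d * \<tau>)" using ends by (intro sin_ge_half) linarith+
      from mult_left_mono[OF this M]
      show "norm (lead_term q (spiral z v \<tau>)) / 2 \<le> Re (v * lead_term q (spiral z v \<tau>))"
        unfolding nm rev by simp
    qed (use v ab r const in auto)
  qed
qed

section \<open>The size of a primitive of a polynomial times an exponential\<close>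

text \<open>Every point far out is the upper end of an ascending spiral whose lower end has a bounded value of
  \<open>h\<close>: on a hill, come out along a ray from a fixed circle; between hill and valley, come along an arc
  from the edge of a valley. In a valley it is the ray inwards that ascends, and its upper end lies
  on the fixed circle, so \<open>h\<close> is bounded there.\<close>

lemma primitive_growth:
  fixes q :: "complex poly" and h h' :: "complex \<Rightarrow> complex"
  assumes q: "degree q > 0"
    and h: "\<forall>\<^sub>F z in at_infinity. (h has_field_derivative h' z) (at z)
             \<and> norm (z * h' z) \<le> C * (norm z ^ degree q * exp_growth q k z)"
    and C: "C \<ge> 0"
  obtains K M where "K \<ge> 0" "M \<ge> 0"
    "\<forall>\<^sub>F z in at_infinity. norm (h z) \<le> M + K * exp_growth q k z"
proof -
  obtain r0 where r0: "\<And>z. r0 \<le> norm z \<Longrightarrow> (h has_field_derivative h' z) (at z)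
             \<and> norm (z * h' z) \<le> C * (norm z ^ degree q * exp_growth q k z)"
    using h unfolding eventually_at_infinity by auto
  obtain \<delta> r1 where \<delta>: "\<delta> > 0" and r1: "r1 \<ge> 1" and incr:
    "\<And>h h' v z a b C r'. r1 \<le> r' \<Longrightarrow> ascends q r' v z a b \<Longrightarrow> C \<ge> 0 \<Longrightarrow>
       (\<And>z. r' \<le> norm z \<Longrightarrow> (h has_field_derivative h' z) (at z)
           \<and> norm (z * h' z) \<le> C * (norm z ^ degree q * exp_growth q k z)) \<Longrightarrow>
       norm (h (spiral z v b) - h (spiral z v a)) \<le> C / \<delta> * exp_growth q k (spiral z v b)"
    using exp_growth_controls_ascent[OF q, where k = k] by metis
  define r where "r = max r0 r1"
  have r: "r0 \<le> r" "r1 \<le> r" "1 \<le> r" "0 < r" using r1 by (auto simp: r_def)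
  define K where "K = C / \<delta>"
  have K: "K \<ge> 0" using C \<delta> by (simp add: K_def)
  have incr: "norm (h (spiral z v b) - h (spiral z v a)) \<le> K * exp_growth q k (spiral z v b)"
    if "ascends q r v z a b" for z v a b
    unfolding K_def using incr[OF r(2) that C, of h h'] r0 r by simp

  define S where "S = sphere (0::complex) r"
  have nz: "z \<noteq> 0" if "z \<in> S" for z using that r by (auto simp: S_def)
  have "continuous_on S h"
    by (intro continuous_at_imp_continuous_on ballI DERIV_isCont)
       (use r0 r in \<open>auto simp: S_def\<close>)
  moreover have "continuous_on S (exp_growth q k)"
    unfolding exp_growth_def [abs_def] using nz by (intro continuous_intros) auto
  ultimately have "continuous_on S (\<lambda>z. norm (h z) + K * exp_growth q k z)"
    by (intro continuous_intros)
  then have "bounded ((\<lambda>z. norm (h z) + K * exp_growth q k z) ` S)"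
    by (intro compact_imp_bounded compact_continuous_image) (auto simp: S_def)
  then obtain M where M: "M > 0"
    and "\<And>z. z \<in> S \<Longrightarrow> \<bar>norm (h z) + K * exp_growth q k z\<bar> \<le> M"
    by (auto simp: bounded_pos)
  then have onS: "norm (h z) + K * exp_growth q k z \<le> M" if "norm z = r" for z
    using that by (force simp: S_def)

  have valley: "norm (h z) \<le> M" if z: "r \<le> norm z" "z \<in> valley q" for z
  proof -
    obtain b where b: "norm (spiral z (- 1) b) = r" "ascends q r (- 1) z 0 b"
      using ascends_radial_valley[OF r(4) z] by metis
    have "norm (h z) \<le> norm (h (spiral z (- 1) b)) + norm (h (spiral z (- 1) b) - h z)"
      by (metis norm_minus_commute norm_triangle_sub)
    with incr[OF b(2)] onS[OF b(1)] show ?thesis by simp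
  qed
  have "norm (h z) \<le> M + K * exp_growth q k z" if z: "r \<le> norm z" for z
  proof -
    have start: "norm (h z) \<le> M + K * exp_growth q k z"
      if "ascends q r v z a 0" "norm (h (spiral z v a)) \<le> M" for v a
      using incr[OF that(1)] that(2) norm_triangle_sub[of "h z" "h (spiral z v a)"] by simp
    consider "z \<in> hill q" | "z \<in> valley q" | "z \<notin> hill q" "z \<notin> valley q" by blast
    then show ?thesis
    proof cases
      case 1
      then obtain a where a: "norm (spiral z 1 a) = r" "ascends q r 1 z a 0"
        using ascends_radial_hill[OF r(4) z] by metis
      have "0 \<le> K * exp_growth q k (spiral z 1 a)" using K by (simp add: exp_growth_nonneg)
      with onS[OF a(1)] show ?thesis by (intro start[OF a(2)]) linarith
    next
      case 2
      from valley[OF z 2] K show ?thesis by (simp add: add_increasing2 exp_growth_nonneg)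
    next
      case 3
      then obtain v a b where ab: "a \<le> 0" "0 \<le> b" and nv: "\<And>\<tau>. norm (spiral z v \<tau>) = norm z"
        and asc: "\<And>r. r \<le> norm z \<Longrightarrow> ascends q r v z a b" and val: "spiral z v a \<in> valley q"
        using arc_valley_to_hill[OF q] by metis
      have "ascends q r v z a 0" using asc[OF z] ab by (auto simp: ascends_def)
      then show ?thesis by (rule start) (use valley val nv z in auto)
    qed
  qed
  then have "\<forall>\<^sub>F z in at_infinity. norm (h z) \<le> M + K * exp_growth q k z"
    unfolding eventually_at_infinity by blast
  with K M show ?thesis using that[of K M] by simp
qed

text \<open>Partial integration gives \<open>f = (p / q') e\<^sup>q + h\<close>, where \<open>h' = -(p / q')' e\<^sup>q\<close> is smaller than \<open>f'\<close> by a
  factor \<open>|z|\<^sup>-\<^sup>d\<close>. By the preceding lemma \<open>h\<close> is, up to a constant, smaller than the main term by the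
  same factor. The constant \<open>M\<close> absorbs the values of \<open>f\<close> in the valleys, where \<open>f\<close> is bounded but
  need not be small.\<close>

lemma exp_poly_primitive_size:
  fixes p q :: "complex poly" and f :: "complex \<Rightarrow> complex"
  assumes p: "p \<noteq> 0" and q: "degree q > 0"
    and f: "\<And>z. (f has_field_derivative poly p z * exp (poly q z)) (at z)"
  defines "m \<equiv> real (degree p) - real (degree q - 1)"
  obtains c C M where "c > 0" "C > 0" "M \<ge> 0"
    "\<forall>\<^sub>F z in at_infinity. c * exp_growth q m z - M \<le> norm (f z) \<and>
        norm (f z) \<le> C * exp_growth q m z + M"
proof -
  define n where "n = degree p"
  define e where "e = degree q - 1"
  define d where "d = degree q"
  have d: "d = Suc e" using q by (simp add: d_def e_def)
  define k where "k = m - real d"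
  have pd: "pderiv q \<noteq> 0" using q by (simp add: pderiv_eq_0_iff)
  have de: "degree (pderiv q) = e" by (simp add: degree_pderiv e_def)
  have gm: "exp_growth q m z = norm z ^ n / norm z ^ e * exp (Re (poly q z))" if "z \<noteq> 0" for z
    using that by (simp add: exp_growth_def m_def powr_diff powr_realpow n_def e_def)
  have gk: "exp_growth q m z = norm z ^ d * exp_growth q k z" if "z \<noteq> 0" for z
    using exp_growth_add[OF that, of q k d] by (simp add: k_def)

  \<comment> \<open>\<open>N\<close> is \<open>z (p' q' - p q'')\<close>, the numerator of \<open>z (p / q')'\<close>.\<close>
  define N where "N = pCons 0 (pderiv p) * pderiv q - p * pCons 0 (pderiv (pderiv q))"
  have "degree (pCons 0 (pderiv p)) \<le> n" "degree (pCons 0 (pderiv (pderiv q))) \<le> e"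
    using de degree_pCons_le[of 0 "pderiv p"] degree_pCons_le[of 0 "pderiv (pderiv q)"]
    by (auto simp: degree_pderiv n_def pderiv_eq_0_iff)
  then have "degree (pCons 0 (pderiv p) * pderiv q) \<le> n + e"
    "degree (p * pCons 0 (pderiv (pderiv q))) \<le> n + e"
    using de add_mono[of _ n _ e] unfolding n_def
    by (meson degree_mult_le order.trans order.refl order_eq_refl)+
  then have "degree N \<le> n + e" unfolding N_def by (rule degree_diff_le)
  then obtain A where A: "A > 0" "\<And>z. norm z \<ge> 1 \<Longrightarrow> norm (poly N z) \<le> A * norm z ^ (n + e)"
    using poly_upper_bound by metis
  obtain P where P: "P > 0" "\<And>z. norm z \<ge> 1 \<Longrightarrow> norm (poly p z) \<le> P * norm z ^ n"
    using poly_upper_bound[of p n] by (auto simp: n_def)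
  obtain Q where Q: "Q > 0" "\<And>z. norm z \<ge> 1 \<Longrightarrow> norm (poly (pderiv q) z) \<le> Q * norm z ^ e"
    using poly_upper_bound[of "pderiv q" e] de by auto
  define P' where "P' = norm (lead_coeff p) / 2"
  define Q' where "Q' = norm (lead_coeff (pderiv q)) / 2"
  have pos: "P' > 0" "Q' > 0" using p pd by (auto simp: P'_def Q'_def)
  have low: "\<forall>\<^sub>F z in at_infinity. P' * norm z ^ n \<le> norm (poly p z) \<and>
      Q' * norm z ^ e \<le> norm (poly (pderiv q) z) \<and> norm z \<ge> 1"
    using poly_lower_bound[OF p] poly_lower_bound[OF pd]
    unfolding P'_def Q'_def n_def de
    by (intro eventually_conj) (auto simp: eventually_at_infinity)

  define E where "E z = poly p z / poly (pderiv q) z * exp (poly q z)" for z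
  define h where "h z = f z - E z" for z
  define h' where "h' z = - ((poly (pderiv p) z * poly (pderiv q) z
      - poly p z * poly (pderiv (pderiv q)) z) / (poly (pderiv q) z)\<^sup>2) * exp (poly q z)" for z
  have "\<forall>\<^sub>F z in at_infinity. (h has_field_derivative h' z) (at z)
             \<and> norm (z * h' z) \<le> A / Q'\<^sup>2 * (norm z ^ degree q * exp_growth q k z)"
    using low
  proof eventually_elim
    case (elim z)
    then have z: "z \<noteq> 0" by auto
    then have "0 < Q' * norm z ^ e" using pos by simp
    with elim have q': "poly (pderiv q) z \<noteq> 0" by auto
    have "(h has_field_derivative poly p z * exp (poly q z) -
       ((poly (pderiv p) z * poly (pderiv q) z - poly p z * poly (pderiv (pderiv q)) z)
          / (poly (pderiv q) z * poly (pderiv q) z) * exp (poly q z)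
        + exp (poly q z) * poly (pderiv q) z * (poly p z / poly (pderiv q) z))) (at z)"
      unfolding h_def E_def using q'
      by (intro DERIV_diff f DERIV_mult DERIV_divide poly_DERIV DERIV_chain2[OF DERIV_exp] q')
    also have "(poly p z * exp (poly q z) -
       ((poly (pderiv p) z * poly (pderiv q) z - poly p z * poly (pderiv (pderiv q)) z)
          / (poly (pderiv q) z * poly (pderiv q) z) * exp (poly q z)
        + exp (poly q z) * poly (pderiv q) z * (poly p z / poly (pderiv q) z))) = h' z"
      using q' by (simp add: h'_def power2_eq_square)
    finally have "(h has_field_derivative h' z) (at z)" .
    moreover have "norm (z * h' z) \<le> A / Q'\<^sup>2 * exp_growth q m z"
    proof -
      have "z * h' z = - (poly N z / (poly (pderiv q) z)\<^sup>2) * exp (poly q z)"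
        by (simp add: h'_def N_def algebra_simps)
      then have "norm (z * h' z) = norm (poly N z) / (norm (poly (pderiv q) z))\<^sup>2 * exp (Re (poly q z))"
        by (simp add: norm_mult norm_divide norm_power)
      also have "\<dots> \<le> (A * norm z ^ (n + e)) / (Q' * norm z ^ e)\<^sup>2 * exp (Re (poly q z))"
        using elim A(2)[of z] pos z A(1)
        by (intro mult_right_mono frac_le power_mono) auto
      also have "\<dots> = A / Q'\<^sup>2 * exp_growth q m z"
        using z by (simp add: gm power_add power_mult_distrib power2_eq_square)
      finally show ?thesis .
    qed
    ultimately show ?case using z by (simp add: gk d_def)
  qed
  moreover have "0 \<le> A / Q'\<^sup>2" using A by simp
  ultimately obtain K M where K: "K \<ge> 0" and M: "M \<ge> 0"
    and hK: "\<forall>\<^sub>F z in at_infinity. norm (h z) \<le> M + K * exp_growth q k z"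
    by (rule primitive_growth[OF q])
  define c where "c = P' / Q"
  define C where "C = P / Q'"
  have c: "c > 0" "C > 0" using pos P Q by (simp_all add: c_def C_def)
  have "\<forall>\<^sub>F z::complex in at_infinity. norm z \<ge> 2 * K / c"
    unfolding eventually_at_infinity by blast
  with low hK have "\<forall>\<^sub>F z in at_infinity. c / 2 * exp_growth q m z - M \<le> norm (f z) \<and>
        norm (f z) \<le> (C + c / 2) * exp_growth q m z + M"
  proof eventually_elim
    case (elim z)
    then have z: "z \<noteq> 0" "norm z \<ge> 1" by auto
    then have zp: "0 < norm z ^ n" "0 < norm z ^ e" by simp_all
    have pz: "P' * norm z ^ n \<le> norm (poly p z)" "norm (poly p z) \<le> P * norm z ^ n"
      and qz: "Q' * norm z ^ e \<le> norm (poly (pderiv q) z)"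
        "norm (poly (pderiv q) z) \<le> Q * norm z ^ e"
      using elim P(2) Q(2) z by auto
    have q'0: "0 < Q' * norm z ^ e" using pos zp by simp
    have E: "norm (E z) = norm (poly p z) / norm (poly (pderiv q) z) * exp (Re (poly q z))"
      by (simp add: E_def norm_mult norm_divide)
    have "c * exp_growth q m z = (P' * norm z ^ n) / (Q * norm z ^ e) * exp (Re (poly q z))"
      using z by (simp add: gm c_def)
    also have "\<dots> \<le> norm (E z)"
      unfolding E using pz qz q'0 by (intro mult_right_mono frac_le) auto
    finally have E1: "c * exp_growth q m z \<le> norm (E z)" .
    have "norm (E z) \<le> (P * norm z ^ n) / (Q' * norm z ^ e) * exp (Re (poly q z))"
      unfolding E using pz qz q'0 P(1) by (intro mult_right_mono frac_le) auto
    also have "\<dots> = C * exp_growth q m z"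
      using z by (simp add: gm C_def)
    finally have E2: "norm (E z) \<le> C * exp_growth q m z" .
    have "K * exp_growth q k z \<le> (c / 2 * norm z ^ 1) * exp_growth q k z"
      using elim c by (intro mult_right_mono exp_growth_nonneg) (simp add: field_simps)
    also have "\<dots> \<le> (c / 2 * norm z ^ d) * exp_growth q k z"
      using c z by (intro mult_right_mono mult_left_mono power_increasing exp_growth_nonneg) (auto simp: d)
    also have "\<dots> = c / 2 * exp_growth q m z" using z by (simp add: gk)
    finally have "norm (h z) \<le> M + c / 2 * exp_growth q m z" using elim by linarith
    moreover have "f z = E z + h z" by (simp add: h_def)
    then have "norm (E z) - norm (h z) \<le> norm (f z)" "norm (f z) \<le> norm (E z) + norm (h z)"
      by (metis norm_diff_ineq, metis norm_triangle_ineq)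
    ultimately show ?case using E1 E2 by (simp add: distrib_right)
  qed
  then show ?thesis using c M by (intro that[of "c / 2" "C + c / 2" M]) auto
qed


section \<open>Growth of a branch of the logarithm\<close>

lemma exp_growth_times_power:
  assumes "degree q > 0" "z \<noteq> 0"
  shows "norm z ^ degree q * exp_growth q (real n - real (degree q - 1)) z
     = norm z ^ Suc n * exp (Re (poly q z))"
proof -
  have "real n - real (degree q - 1) + real (degree q) = real (Suc n)"
    using assms(1) by simp
  moreover have "norm z powr real (Suc n) = norm z ^ Suc n"
    using assms(2) by (intro powr_realpow) simp
  ultimately show ?thesis
    using exp_growth_add[OF assms(2), of q "real n - real (degree q - 1)" "degree q"]
    by (metis exp_growth_def)
qed

lemma lead_term_continuous: "continuous_on S (lead_term q)"
  unfolding lead_term_def [abs_def] by (intro continuous_intros)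

lemma closed_hill: "closed (hill q)"
  unfolding hill_def by (intro closed_Collect_le continuous_intros lead_term_continuous) auto

lemma hill_valley_Re_poly:
  fixes q :: "complex poly"
  assumes q: "degree q > 0"
  shows "\<forall>\<^sub>F z in at_infinity.
    (z \<in> hill q \<longrightarrow> norm (lead_coeff q) / 4 * norm z \<le> Re (poly q z)) \<and>
    (z \<in> valley q \<longrightarrow> Re (poly q z) \<le> - (norm (lead_coeff q) / 4 * norm z))"
proof -
  define l where "l = norm (lead_coeff q)"
  have "q \<noteq> 0" using q by auto
  then have l: "l > 0" by (simp add: l_def)
  have "\<forall>\<^sub>F z in at_infinity. norm (poly q z - lead_term q z) \<le> l / 4 * norm z ^ degree q"
    using l by (intro poly_lead_term_close) auto
  moreover have "\<forall>\<^sub>F z::complex in at_infinity. norm z \<ge> 1"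
    by (auto simp: eventually_at_infinity)
  ultimately show ?thesis
    unfolding l_def[symmetric]
  proof eventually_elim
    case (elim z)
    have "norm z ^ 1 \<le> norm z ^ degree q" using elim q by (intro power_increasing) auto
    then have "l / 4 * norm z \<le> l / 4 * norm z ^ degree q"
      using l by (intro mult_left_mono) auto
    moreover have "\<bar>Re (poly q z) - Re (lead_term q z)\<bar> \<le> l / 4 * norm z ^ degree q"
      using abs_Re_le_cmod[of "poly q z - lead_term q z"] elim by simp
    moreover have "norm (lead_term q z) = l * norm z ^ degree q"
      by (simp add: lead_term_def l_def norm_mult norm_power)
    ultimately show ?case unfolding hill_def valley_def mem_Collect_eq by linarith
  qed
qed

lemma eventually_norm_at_infinity:
  "eventually P at_top \<Longrightarrow> \<forall>\<^sub>F z::complex in at_infinity. P (norm z)"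
  using eventually_compose_filterlim[OF _ filterlim_at_infinity_imp_norm_at_top[OF filterlim_ident]]
  by blast

text \<open>On hills and in valleys \<open>|Re q|\<close> is at least a multiple of \<open>|z|\<close>, which beats every power of \<open>|z|\<close>.\<close>

lemma exp_growth_hill_valley:
  fixes q :: "complex poly"
  assumes q: "degree q > 0" and B: "B > 0"
  shows "\<forall>\<^sub>F z in at_infinity. (z \<in> hill q \<longrightarrow> B \<le> exp_growth q m z) \<and>
           (z \<in> valley q \<longrightarrow> exp_growth q m z < B)"
proof -
  define l where "l = norm (lead_coeff q) / 4"
  have "q \<noteq> 0" using q by auto
  then have l: "l > 0" by (simp add: l_def)
  have "\<forall>\<^sub>F x::real in at_top. B \<le> x powr m * exp (l * x)"
    using l by real_asymp
  moreover have "\<forall>\<^sub>F x::real in at_top. x powr m * exp (- l * x) < B"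
    using l B by real_asymp
  ultimately have "\<forall>\<^sub>F x::real in at_top. B \<le> x powr m * exp (l * x) \<and> x powr m * exp (- l * x) < B"
    by (rule eventually_conj)
  from eventually_norm_at_infinity[OF this] hill_valley_Re_poly[OF q]
  show ?thesis
    unfolding l_def[symmetric]
  proof eventually_elim
    case (elim z)
    have mono: "norm z powr m * exp x \<le> norm z powr m * exp y" if "x \<le> y" for x y
      using that by (simp add: mult_left_mono)
    show ?case
      using elim mono[of "l * norm z" "Re (poly q z)"] mono[of "Re (poly q z)" "- (l * norm z)"]
      by (auto simp: exp_growth_def)
  qed
qed

lemma log_branch_has_derivative:
  assumes L: "log_branch_on D f L" and D: "open D" "z \<in> D"
    and f: "(f has_field_derivative f') (at z)"
  shows "(L has_field_derivative f' / f z) (at z)"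
proof -
  have "L field_differentiable at z"
    using L D by (auto simp: log_branch_on_def intro: holomorphic_on_imp_differentiable_at)
  then obtain L' where L': "(L has_field_derivative L') (at z)"
    by (auto simp: field_differentiable_def)
  then have "((\<lambda>w. exp (L w)) has_field_derivative exp (L z) * L') (at z)"
    by (rule DERIV_chain2[OF DERIV_exp])
  moreover have "exp (L w) = f w" if "w \<in> D" for w
    using L that by (simp add: log_branch_on_def)
  ultimately have "(f has_field_derivative exp (L z) * L') (at z)"
    using D by (auto intro: has_field_derivative_transform_within_open)
  then have "f' = f z * L'" "f z \<noteq> 0"
    using DERIV_unique[OF f] L D by (auto simp: log_branch_on_def)
  with L' show ?thesis by simp
qed

text \<open>The region \<open>U\<close> where \<open>|z| \<ge> r\<close> and the growth function is at least \<open>B\<close> lies in the tracts, and there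
  \<open>|f|\<close> is at least a multiple of the growth function, so that \<open>|z L'(z)| = |z f'(z) / f(z)|\<close> is
  \<open>O(|z|\<^sup>d)\<close>. Every point of \<open>U\<close> is joined inside \<open>U\<close>, by an arc uphill and then a ray inwards, to the
  part \<open>S\<close> of the circle \<open>|z| = r\<close> that lies on the hills; integration along this path shows that \<open>L\<close>
  changes by \<open>O(|z|\<^sup>d)\<close>. The branch is arbitrary on each tract, but compactness of \<open>S\<close> bounds all the
  constants at once, without any count of the tracts.\<close>

lemma log_branch_growth:
  fixes p q :: "complex poly" and f L :: "complex \<Rightarrow> complex"
  assumes q: "degree q > 0"
    and f: "\<And>z. (f has_field_derivative poly p z * exp (poly q z)) (at z)"
    and L: "log_branch_on (tracts f R) f L"
    and c: "c > 0"
    and size: "\<forall>\<^sub>F z in at_infinity. c * exp_growth q m z - M \<le> norm (f z)"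
    and m: "m = real (degree p) - real (degree q - 1)"
  obtains B D where "B > 0" "D > 0"
    "\<forall>\<^sub>F z in at_infinity. B \<le> exp_growth q m z \<longrightarrow> norm (L z) \<le> D * norm z ^ degree q"
proof -
  define d where "d = degree q"
  define n where "n = degree p"
  have d: "d > 0" using q by (simp add: d_def)
  \<comment> \<open>Large enough that on \<open>U\<close> both \<open>|f| > R\<close> holds and \<open>M\<close> is at most half of \<open>c\<close> times the growth
    function.\<close>
  define B where "B = 2 * (\<bar>M\<bar> + \<bar>R\<bar> + 1) / c"
  have B: "B > 0" using c by (simp add: B_def)
  have cB: "c * B = 2 * (\<bar>M\<bar> + \<bar>R\<bar> + 1)" using c by (simp add: B_def)
  obtain P where P: "P > 0" "\<And>z. norm z \<ge> 1 \<Longrightarrow> norm (poly p z) \<le> P * norm z ^ n"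
    using poly_upper_bound[of p n] by (auto simp: n_def)
  obtain r0 where r0: "\<And>z. r0 \<le> norm z \<Longrightarrow> c * exp_growth q m z - M \<le> norm (f z) \<and>
      (z \<in> hill q \<longrightarrow> B \<le> exp_growth q m z) \<and> (z \<in> valley q \<longrightarrow> exp_growth q m z < B)"
    using eventually_conj[OF size exp_growth_hill_valley[OF q B]]
    unfolding eventually_at_infinity by blast
  obtain r1 where r1: "r1 \<ge> 1" and mono: "\<And>v z a b. ascends q r1 v z a b
       \<Longrightarrow> exp_growth q m (spiral z v a) \<le> exp_growth q m (spiral z v b)"
    using exp_growth_controls_ascent[OF q, where k = m] by metis
  define r where "r = max r0 r1"
  have r: "r0 \<le> r" "r1 \<le> r" "1 \<le> r" "0 < r" using r1 by (auto simp: r_def)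

  have "continuous_on UNIV f"
    using f by (intro continuous_at_imp_continuous_on ballI DERIV_isCont) auto
  then have opn: "open (tracts f R)"
    unfolding tracts_def by (intro open_vimage open_Collect_less continuous_intros) auto
  define U where "U = {z. r \<le> norm z \<and> B \<le> exp_growth q m z}"
  define A where "A = 2 * P / c"
  have A: "A > 0" using P c by (simp add: A_def)
  have L': "z \<in> tracts f R \<and> (L has_field_derivative poly p z * exp (poly q z) / f z) (at z) \<and>
      norm (z * (poly p z * exp (poly q z) / f z)) \<le> A * norm z ^ d" if "z \<in> U" for z
  proof -
    have z: "1 \<le> norm z" "z \<noteq> 0" and V: "B \<le> exp_growth q m z"
      and fz: "c * exp_growth q m z - M \<le> norm (f z)"
      using that r r0 by (auto simp: U_def)
    have "c * B \<le> c * exp_growth q m z" using V c by (intro mult_left_mono) auto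
    with fz cB have large: "R < norm (f z)" "c / 2 * exp_growth q m z \<le> norm (f z)" by auto
    have pos: "0 < exp_growth q m z" using z by (intro exp_growth_pos)
    have V': "norm z ^ d * exp_growth q m z = norm z ^ Suc n * exp (Re (poly q z))"
      using exp_growth_times_power[OF q z(2), of n] by (simp add: m n_def d_def)
    have "norm (z * (poly p z * exp (poly q z) / f z))
        = norm z * norm (poly p z) * exp (Re (poly q z)) / norm (f z)"
      by (simp add: norm_mult norm_divide)
    also have "\<dots> \<le> norm z * (P * norm z ^ n) * exp (Re (poly q z)) / (c / 2 * exp_growth q m z)"
      using P z large pos c by (intro frac_le mult_right_mono mult_left_mono) auto
    also have "\<dots> = P * (norm z ^ d * exp_growth q m z) / (c / 2 * exp_growth q m z)"
      unfolding V' by simp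
    also have "\<dots> = A * norm z ^ d" using pos c by (simp add: A_def)
    finally show ?thesis
      using log_branch_has_derivative[OF L opn _ f, of z] large by (auto simp: tracts_def)
  qed
  have path: "norm (L (spiral z v b) - L (spiral z v a)) \<le> \<phi> b - \<phi> a"
    if "a \<le> b" "norm v = 1" and U: "\<And>\<tau>. \<tau> \<in> {a..b} \<Longrightarrow> spiral z v \<tau> \<in> U"
      and \<phi>: "\<And>\<tau>. (\<phi> has_real_derivative A * norm (spiral z v \<tau>) ^ d) (at \<tau>)" for z v a b \<phi>
  proof (rule differentiable_bound_along[OF \<open>a \<le> b\<close>])
    let ?\<gamma> = "spiral z v"
    let ?L' = "\<lambda>z. poly p z * exp (poly q z) / f z"
    fix \<tau> assume \<tau>: "\<tau> \<in> {a..b}"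
    show "((\<lambda>\<tau>. L (?\<gamma> \<tau>)) has_vector_derivative (v * ?\<gamma> \<tau>) * ?L' (?\<gamma> \<tau>)) (at \<tau>)"
    proof -
      have "(L has_field_derivative ?L' (?\<gamma> \<tau>)) (at (?\<gamma> \<tau>))"
        using L'[OF U[OF \<tau>]] by blast
      from field_vector_diff_chain_at[OF spiral_has_vector_derivative this]
      show ?thesis unfolding o_def .
    qed
    show "(\<phi> has_vector_derivative A * norm (?\<gamma> \<tau>) ^ d) (at \<tau>)"
      using \<phi> by (simp add: has_real_derivative_iff_has_vector_derivative)
    have "norm ((v * ?\<gamma> \<tau>) * ?L' (?\<gamma> \<tau>)) = norm (?\<gamma> \<tau> * ?L' (?\<gamma> \<tau>))"
      by (simp only: norm_mult \<open>norm v = 1\<close> mult_1)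
    with L'[OF U[OF \<tau>]] show "norm ((v * ?\<gamma> \<tau>) * ?L' (?\<gamma> \<tau>)) \<le> A * norm (?\<gamma> \<tau>) ^ d"
      by simp
  qed

  have hillU: "z \<in> U" if "z \<in> hill q" "r \<le> norm z" for z
    using that r0[of z] r by (auto simp: U_def)
  define S where "S = sphere 0 r \<inter> hill q"
  have "S \<subseteq> tracts f R" using L' hillU by (auto simp: S_def)
  moreover have "continuous_on (tracts f R) L"
    using L by (auto simp: log_branch_on_def intro: holomorphic_on_imp_continuous_on)
  ultimately have "continuous_on S L" by (rule continuous_on_subset[rotated])
  moreover have "compact S" unfolding S_def by (intro compact_Int_closed closed_hill) auto
  ultimately have "bounded (L ` S)" by (intro compact_imp_bounded compact_continuous_image)
  then obtain M2 where M2: "M2 > 0" "\<And>z. z \<in> S \<Longrightarrow> norm (L z) \<le> M2"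
    by (auto simp: bounded_pos)

  have hill: "norm (L z) \<le> M2 + A * norm z ^ d" if z: "z \<in> hill q" "r \<le> norm z" for z
  proof -
    obtain a where a: "a \<le> 0" "norm (spiral z 1 a) = r" "ascends q r 1 z a 0"
      and inhill: "\<And>\<tau>. spiral z 1 \<tau> \<in> hill q"
      using ascends_radial_hill[OF r(4) z(2,1)] by metis
    have "norm (L (spiral z 1 0) - L (spiral z 1 a))
        \<le> A / d * norm (spiral z 1 0) ^ d - A / d * norm (spiral z 1 a) ^ d"
    proof (rule path[OF a(1)])
      show "spiral z 1 \<tau> \<in> U" if "\<tau> \<in> {a..0}" for \<tau>
        using that a(3) inhill by (intro hillU) (auto simp: ascends_def)
      show "((\<lambda>\<tau>. A / d * norm (spiral z 1 \<tau>) ^ d) has_real_derivative A * norm (spiral z 1 \<tau>) ^ d) (at \<tau>)"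
        for \<tau> unfolding norm_spiral power_mult_distrib exp_of_nat_mult[symmetric] using d
        by (auto intro!: derivative_eq_intros)
    qed simp
    also have "\<dots> \<le> A / d * norm z ^ d" using A by simp
    also have "\<dots> \<le> A * norm z ^ d"
      using A d by (intro mult_right_mono) (auto simp: field_simps)
    finally have "norm (L z - L (spiral z 1 a)) \<le> A * norm z ^ d" by simp
    moreover have "norm (L (spiral z 1 a)) \<le> M2" using a(2) inhill by (intro M2) (simp add: S_def)
    ultimately show ?thesis using norm_triangle_sub[of "L z" "L (spiral z 1 a)"] by linarith
  qed
  have "norm (L z) \<le> M2 + A * norm z ^ d + A * norm z ^ d * pi" if z: "z \<in> U" for z
  proof (cases "z \<in> hill q")
    case True
    have "0 \<le> A * norm z ^ d * pi" using A by simp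
    with hill[OF True] z show ?thesis by (force simp: U_def)
  next
    case False
    have rz: "r \<le> norm z" and "z \<notin> valley q" using z r0[of z] r by (auto simp: U_def)
    with False obtain v a b where ab: "a \<le> 0" "0 \<le> b" "b \<le> pi" and v: "norm v = 1"
      and nv: "\<And>\<tau>. norm (spiral z v \<tau>) = norm z"
      and asc: "\<And>r. r \<le> norm z \<Longrightarrow> ascends q r v z a b" and top: "spiral z v b \<in> hill q"
      using arc_valley_to_hill[OF q] by metis
    have "norm (L (spiral z v b) - L (spiral z v 0)) \<le> A * norm z ^ d * b - A * norm z ^ d * 0"
    proof (rule path[OF ab(2) v])
      show "spiral z v \<tau> \<in> U" if "\<tau> \<in> {0..b}" for \<tau>
      proof -
        have "ascends q r1 v z 0 \<tau>"
          using asc[of r1] that ab rz r by (auto simp: ascends_def)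
        from mono[OF this] show ?thesis using z rz by (auto simp: U_def nv)
      qed
    qed (auto simp: nv intro!: derivative_eq_intros)
    also have "\<dots> \<le> A * norm z ^ d * pi" using A ab by (simp add: mult_left_mono)
    finally have "norm (L z - L (spiral z v b)) \<le> A * norm z ^ d * pi"
      by (simp add: norm_minus_commute)
    moreover have "norm (L (spiral z v b)) \<le> M2 + A * norm z ^ d"
      using hill[OF top] nv[of b] rz by simp
    ultimately show ?thesis using norm_triangle_sub[of "L z" "L (spiral z v b)"] by linarith
  qed
  moreover have "M2 + A * norm z ^ d + A * norm z ^ d * pi \<le> (M2 + A + A * pi) * norm z ^ d"
    if "r \<le> norm z" for z :: complex
  proof -
    have "M2 * 1 \<le> M2 * norm z ^ d" using M2(1) that r by (intro mult_left_mono one_le_power) auto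
    then show ?thesis by (simp add: algebra_simps)
  qed
  ultimately have "norm (L z) \<le> (M2 + A + A * pi) * norm z ^ d"
    if "r \<le> norm z" "B \<le> exp_growth q m z" for z
    using that by (force simp: U_def)
  then have "\<forall>\<^sub>F z in at_infinity. B \<le> exp_growth q m z \<longrightarrow>
      norm (L z) \<le> (M2 + A + A * pi) * norm z ^ degree q"
    unfolding eventually_at_infinity d_def by blast
  with B show ?thesis using that[of B "M2 + A + A * pi"] M2 A by (simp add: add_pos_pos)
qed

lemma poly_exp_integral_has_derivative:
  "(poly_exp_integral p q c has_field_derivative poly p z * exp (poly q z)) (at z)"
proof -
  define g where "g = (\<lambda>z. poly p z * exp (poly q z))"
  have "g holomorphic_on UNIV" unfolding g_def by (intro holomorphic_intros)
  then obtain G where G: "\<And>z. (G has_field_derivative g z) (at z)"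
    using holomorphic_convex_primitive'[of UNIV g] by auto
  have "contour_integral (linepath 0 z) g = G z - G 0" for z
    using contour_integral_primitive[of UNIV G g "linepath 0 z"] G
    by (intro contour_integral_unique) auto
  then have "poly_exp_integral p q c = (\<lambda>z. G z - G 0 + c)"
    by (simp add: poly_exp_integral_def g_def fun_eq_iff)
  then show ?thesis
    using G by (auto simp: g_def intro!: derivative_eq_intros)
qed

section \<open>The logarithmic derivative of f in its tracts\<close>

theorem proposition9p1:
  fixes p q :: "complex poly" and c :: complex and f L F :: "complex \<Rightarrow> complex" and R :: real
  assumes "p \<noteq> 0"
    and "degree q > 0"
    and "f = poly_exp_integral p q c"
    and "R > max 1 (cmod (f 0))"
    and "sing_inv f \<subseteq> {z. cmod z < R}"
    and "log_branch_on (tracts f R) f L"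
    and "F = log_transform L"
  shows "\<exists>t > 0. \<exists>\<beta> > 0. exp t > R \<and>
      (\<forall>z. cmod (f z) \<ge> exp t \<longrightarrow> cmod (z * deriv f z / f z) \<ge> \<beta> * cmod (L z)) \<and>
      (\<forall>w \<in> log_transform_domain f R. Re (F w) \<ge> t \<longrightarrow> cmod (deriv F w) \<ge> \<beta> * cmod (F w))"
proof -
  note p = assms(1) and q = assms(2) and L = assms(6)
  define d where "d = degree q"
  define n where "n = degree p"
  define m where "m = real (degree p) - real (degree q - 1)"
  have f: "(f has_field_derivative poly p z * exp (poly q z)) (at z)" for z
    unfolding assms(3) by (rule poly_exp_integral_has_derivative)
  then have f': "deriv f z = poly p z * exp (poly q z)" for z by (rule DERIV_imp_deriv)
  obtain c1 C M where c1: "c1 > 0" and C: "C > 0" and M: "M \<ge> 0"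
    and size: "\<forall>\<^sub>F z in at_infinity. c1 * exp_growth q m z - M \<le> norm (f z) \<and>
        norm (f z) \<le> C * exp_growth q m z + M"
    unfolding m_def by (rule exp_poly_primitive_size[OF p q f])
  have lower: "\<forall>\<^sub>F z in at_infinity. c1 * exp_growth q m z - M \<le> norm (f z)"
    using size by eventually_elim simp
  obtain B D where B: "B > 0" and D: "D > 0"
    and growth: "\<forall>\<^sub>F z in at_infinity. B \<le> exp_growth q m z \<longrightarrow> norm (L z) \<le> D * norm z ^ degree q"
    by (rule log_branch_growth[OF q f L c1 lower m_def])
  define P where "P = norm (lead_coeff p) / 2"
  have P: "P > 0" using p by (simp add: P_def)
  \<comment> \<open>Where the growth function is at least \<open>B\<close>, the constant \<open>M\<close> is at most \<open>M / B\<close> times it, and so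
    \<open>|f|\<close> is at most \<open>H\<close> times it.\<close>
  define H where "H = C + M / B"
  have H: "H > 0" using C M B by (simp add: H_def add_pos_nonneg)
  define \<beta> where "\<beta> = P / (H * D)"
  have \<beta>: "\<beta> > 0" using P H D by (simp add: \<beta>_def)
  have "\<forall>\<^sub>F z::complex in at_infinity. norm z \<ge> 1"
    by (auto simp: eventually_at_infinity)
  with size growth poly_lower_bound[OF p]
  have "\<forall>\<^sub>F z in at_infinity. C * B + M < norm (f z) \<longrightarrow> \<beta> * norm (L z) \<le> norm (z * deriv f z / f z)"
  proof eventually_elim
    case (elim z)
    then have z: "z \<noteq> 0" by auto
    let ?V = "exp_growth q m z"
    have V0: "?V > 0" using z by (rule exp_growth_pos)
    show ?case
    proof
      assume fz: "C * B + M < norm (f z)"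
      then have "C * B \<le> C * ?V" using elim by linarith
      then have V: "B \<le> ?V" using C by simp
      have "0 \<le> C * B" using C B by simp
      then have fpos: "norm (f z) > 0" using fz M by linarith
      have "M / B * B \<le> M / B * ?V" using V M B by (intro mult_left_mono) auto
      then have fH: "norm (f z) \<le> H * ?V" using elim B by (simp add: H_def distrib_right)
      have V': "norm z ^ d * ?V = norm z ^ Suc n * exp (Re (poly q z))"
        using exp_growth_times_power[OF q z, of n] by (simp add: m_def n_def d_def)
      have "\<beta> * norm (L z) \<le> \<beta> * (D * norm z ^ d)"
        using elim V \<beta> by (intro mult_left_mono) (auto simp: d_def)
      also have "\<dots> = P * (norm z ^ d * ?V) / (H * ?V)"
        using V0 H D by (simp add: \<beta>_def)
      also have "\<dots> = norm z * (P * norm z ^ n) * exp (Re (poly q z)) / (H * ?V)"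
        unfolding V' by simp
      also have "\<dots> \<le> norm z * norm (poly p z) * exp (Re (poly q z)) / norm (f z)"
        using elim fH fpos by (intro frac_le mult_right_mono mult_left_mono) (auto simp: P_def n_def)
      also have "\<dots> = norm (z * deriv f z / f z)"
        by (simp add: f' norm_mult norm_divide)
      finally show "\<beta> * norm (L z) \<le> norm (z * deriv f z / f z)" .
    qed
  qed
  then obtain r where r: "\<And>z. r \<le> norm z \<Longrightarrow> C * B + M < norm (f z) \<Longrightarrow>
      \<beta> * norm (L z) \<le> norm (z * deriv f z / f z)"
    unfolding eventually_at_infinity by blast
  have contf: "continuous_on UNIV f"
    using f by (intro continuous_at_imp_continuous_on ballI DERIV_isCont) auto
  then have "bounded (f ` cball 0 r)"
    by (intro compact_imp_bounded compact_continuous_image) (auto intro: continuous_on_subset)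
  then obtain N where N: "N > 0" "\<And>z. norm z \<le> r \<Longrightarrow> norm (f z) \<le> N"
    by (auto simp: bounded_pos)
  \<comment> \<open>Values of modulus at least \<open>e\<^sup>t > t\<close> are not attained in the disc of radius \<open>r\<close>, and where they
    are attained the growth function is at least \<open>B\<close>.\<close>
  define t where "t = R + N + C * B + M"
  have R: "R > 1" using assms(4) by simp
  have "C * B > 0" using C B by simp
  then have t: "t > 0" "R \<le> t" "N \<le> t" "C * B + M \<le> t" using R N M by (auto simp: t_def)
  have et: "t < exp t" using exp_ge_add_one_self[of t] by linarith
  have main: "\<beta> * norm (L z) \<le> norm (z * deriv f z / f z)" if "exp t \<le> norm (f z)" for z
    using r[of z] N(2)[of z] that t et by linarith
  have "\<beta> * norm (F w) \<le> norm (deriv F w)"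
    if w: "w \<in> log_transform_domain f R" "t \<le> Re (F w)" for w
  proof -
    have opn: "open (tracts f R)"
      using contf unfolding tracts_def by (intro open_vimage open_Collect_less continuous_intros) auto
    have dom: "exp w \<in> tracts f R" using w by (simp add: log_transform_domain_def)
    have F: "F = (\<lambda>w. L (exp w))" by (simp add: assms(7) log_transform_def fun_eq_iff)
    have "(F has_field_derivative deriv f (exp w) / f (exp w) * exp w) (at w)"
      unfolding F f' by (rule DERIV_chain2[OF log_branch_has_derivative[OF L opn dom f] DERIV_exp])
    then have "deriv F w = exp w * deriv f (exp w) / f (exp w)"
      by (simp add: DERIV_imp_deriv mult.commute)
    moreover have "norm (f (exp w)) = exp (Re (F w))"
      using L dom unfolding log_branch_on_def F by (metis norm_exp_eq_Re)
    ultimately show ?thesis using main[of "exp w"] w(2) by (simp add: F)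
  qed
  with main t et \<beta> show ?thesis by (intro exI[of _ t] conjI exI[of _ \<beta>]) auto
qed

end
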